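(* Let $\mathsf G$ be a discrete group, $(\mathcal A,\alpha,\omega)$ a twisted $C^*$-dynamical system with group $\mathsf G$ and center-valued $2$-cocycle $\omega$, and $\mathcal L(\mathsf G)$ an admissible algebra. For $f\in\mathcal L_{\alpha,\omega}(\mathsf G;\mathcal A)$ define $(\Gamma f)(x,y):=\alpha_{x^{-1}}[f(xy^{-1})]$, $x,y\in\mathsf G$. (1) $\Gamma:\mathcal L_{\alpha,\omega}(\mathsf G;\mathcal A)\to\mathscr K^{\mathcal L}_{\alpha,\omega}(\mathsf G\times\mathsf G;\mathcal A)$ is an isometric $*$-morphism. (2) The range of $\Gamma$ is the space of covariant kernels $$\mathscr K^{\mathcal L}_{\alpha,\omega}(\mathsf G\times\mathsf G;\mathcal A)_{\rm cov}:=\{K\in\mathscr K^{\mathcal L}_{\alpha,\omega}(\mathsf G\times\mathsf G;\mathcal A)\mid K(xz,yz)=\alpha_{z^{-1}}[K(x,y)]\ \ \forall x,y,z\in\mathsf G\},$$ and on this space the inverse is given by $(\Gamma^{-1}K)(x)=\alpha_x[K(x,\mathsf e)]$.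
   Context: Banach $*$-algebras have submultiplicative norm and isometric involution. For a discrete group $\mathsf G$ with unit $\mathsf e$, $\ell^1(\mathsf G)$ has product $(k\star l)(x)=\sum_{y}k(y)l(y^{-1}x)$ and involution $k^\star(x)=\overline{k(x^{-1})}$. An admissible algebra is a subspace $\mathcal L(\mathsf G)\subset\ell^1(\mathsf G)$ with its own complete norm $\|\cdot\|_{\mathcal L}$, stronger than the $\ell^1$-norm, such that (i) it is solid: if $|k(x)|\le|l(x)|$ for all $x$ and $l\in\mathcal L(\mathsf G)$, then $k\in\mathcal L(\mathsf G)$ and $\|k\|_{\mathcal L}\le\|l\|_{\mathcal L}$; (ii) $(\mathcal L(\mathsf G),\star,{}^\star,\|\cdot\|_{\mathcal L})$ is a unital Banach $*$-algebra. A twisted $C^*$-dynamical system $(\mathcal A,\alpha,\omega)$ with center-valued cocycle consists of a $C^*$-algebra $\mathcal A$, a map $\alpha:\mathsf G\to\mathrm{Aut}(\mathcal A)$ and a map $\omega:\mathsf G\times\mathsf G\to\mathcal{UM}(\mathcal A)$ (unitary group of the multiplier algebra $\mathcal M(\mathcal A)$, equal to $\mathcal A$ if $\mathcal A$ is unital) with values in the center of $\mathcal M(\mathcal A)$, such that for all $x,y,z$: $\alpha_x\circ\alpha_y=\alpha_{xy}$, $\omega(x,y)\omega(xy,z)=\alpha_x[\omega(y,z)]\omega(x,yz)$, $\omega(x,\mathsf e)=1=\omega(\mathsf e,x)$ (automorphisms are extended to $\mathcal M(\mathcal A)$). $\mathcal L_{\alpha,\omega}(\mathsf G;\mathcal A)$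 is the Banach $*$-algebra of functions $f\in\ell^1(\mathsf G;\mathcal A)$ with $\|f(\cdot)\|_{\mathcal A}\in\mathcal L(\mathsf G)$, norm $\big\|\,\|f(\cdot)\|_{\mathcal A}\big\|_{\mathcal L}$, product $(f\diamond g)(x)=\sum_{y}f(y)\,\alpha_y[g(y^{-1}x)]\,\omega(y,y^{-1}x)$ and involution $f^{\diamond}(x)=\omega(x,x^{-1})^*\alpha_x[f(x^{-1})]^*$. $\mathscr K^{\mathcal L}_{\alpha,\omega}(\mathsf G\times\mathsf G;\mathcal A)$ is the Banach $*$-algebra of functions $K:\mathsf G\times\mathsf G\to\mathcal A$ for which there is $k\in\mathcal L(\mathsf G)$ with $\|K(x,y)\|_{\mathcal A}\le|k(xy^{-1})|$ for all $x,y$; its norm is the infimum of $\|k\|_{\mathcal L}$ over all such $k$; its composition and involution are $$(K\bullet_{\alpha,\omega}L)(x,y)=\sum_{z\in\mathsf G}K(x,z)L(z,y)\,\alpha_{x^{-1}}[\omega(xz^{-1},zy^{-1})],\qquad K^{\bullet_{\alpha,\omega}}(x,y)=\alpha_{x^{-1}}[\omega(xy^{-1},yx^{-1})^*]\,K(y,x)^*.$$ *)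

theory Defs
  imports "HOL-Analysis.Analysis" "HOL-Library.Function_Algebras"
begin

text \<open>
  Discrete groups are types of class \<open>group_add\<close>, which is not assumed commutative. The group is
  therefore written additively: \<open>xy\<close>, \<open>xy\<inverse>\<close>, \<open>y\<inverse>x\<close>, \<open>x\<inverse>\<close>, \<open>e\<close> of the multiplicative notation are
  \<open>x + y\<close>, \<open>x - y\<close>, \<open>- y + x\<close>, \<open>- x\<close>, \<open>0\<close>.
\<close>

section \<open>C*-algebras and their multipliers\<close>

text \<open>Complex, complete, not necessarily unital, possibly zero.\<close>

class cstar_algebra = real_normed_algebra + banach +
  fixes scaleC :: "complex \<Rightarrow> 'a \<Rightarrow> 'a" (infixr "*\<^sub>C" 75)
    and adj :: "'a \<Rightarrow> 'a"
  assumes scaleR_scaleC: "r *\<^sub>R a = complex_of_real r *\<^sub>C a"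
    and scaleC_add_right: "c *\<^sub>C (a + b) = c *\<^sub>C a + c *\<^sub>C b"
    and scaleC_add_left: "(c + d) *\<^sub>C a = c *\<^sub>C a + d *\<^sub>C a"
    and scaleC_scaleC: "c *\<^sub>C d *\<^sub>C a = (c * d) *\<^sub>C a"
    and norm_scaleC: "norm (c *\<^sub>C a) = cmod c * norm a"
    and mult_scaleC_left: "(c *\<^sub>C a) * b = c *\<^sub>C (a * b)"
    and mult_scaleC_right: "a * (c *\<^sub>C b) = c *\<^sub>C (a * b)"
    and adj_adj: "adj (adj a) = a"
    and adj_add: "adj (a + b) = adj a + adj b"
    and adj_scaleC: "adj (c *\<^sub>C a) = cnj c *\<^sub>C adj a"
    and adj_mult: "adj (a * b) = adj b * adj a"
    and cstar_identity: "norm (adj a * a) = (norm a)\<^sup>2"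

definition star_automorphism :: "('a::cstar_algebra \<Rightarrow> 'a) \<Rightarrow> bool" where
  "star_automorphism \<phi> \<longleftrightarrow> bij \<phi> \<and>
     (\<forall>a b. \<phi> (a + b) = \<phi> a + \<phi> b) \<and> (\<forall>c a. \<phi> (c *\<^sub>C a) = c *\<^sub>C \<phi> a) \<and>
     (\<forall>a b. \<phi> (a * b) = \<phi> a * \<phi> b) \<and> (\<forall>a. \<phi> (adj a) = adj (\<phi> a))"

definition bounded_clinear :: "('a::cstar_algebra \<Rightarrow> 'a) \<Rightarrow> bool" where
  "bounded_clinear T \<longleftrightarrow> bounded_linear T \<and> (\<forall>c a. T (c *\<^sub>C a) = c *\<^sub>C T a)"

text \<open>
  The multiplier algebra is realised by double centralizers: \<open>m = (L, R)\<close> acts by \<open>m a = L a\<close> and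
  \<open>a m = R a\<close>. An element \<open>b\<close> of the algebra is identified with \<open>(\<lambda>a. b * a, \<lambda>a. a * b)\<close>.
\<close>

type_synonym 'a double_map = "('a \<Rightarrow> 'a) \<times> ('a \<Rightarrow> 'a)"

abbreviation left_act :: "'a double_map \<Rightarrow> 'a \<Rightarrow> 'a" where
  "left_act m a \<equiv> fst m a"

abbreviation right_act :: "'a \<Rightarrow> 'a double_map \<Rightarrow> 'a" where
  "right_act a m \<equiv> snd m a"

definition multipliers :: "'a::cstar_algebra double_map set" where
  "multipliers = {m. bounded_clinear (left_act m) \<and> bounded_clinear (\<lambda>a. right_act a m) \<and>
     (\<forall>a b. left_act m (a * b) = left_act m a * b) \<and>
     (\<forall>a b. right_act (a * b) m = a * right_act b m) \<and>
     (\<forall>a b. a * left_act m b = right_act a m * b)}"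

definition mult_one :: "'a double_map" where
  "mult_one = (\<lambda>a. a, \<lambda>a. a)"

definition mult_prod :: "'a double_map \<Rightarrow> 'a double_map \<Rightarrow> 'a double_map" where
  "mult_prod m n = (\<lambda>a. left_act m (left_act n a), \<lambda>a. right_act (right_act a m) n)"

definition mult_adj :: "'a::cstar_algebra double_map \<Rightarrow> 'a double_map" where
  "mult_adj m = (\<lambda>a. adj (right_act (adj a) m), \<lambda>a. adj (left_act m (adj a)))"

definition unitary_multipliers :: "'a::cstar_algebra double_map set" where
  "unitary_multipliers =
     {u \<in> multipliers. mult_prod (mult_adj u) u = mult_one \<and> mult_prod u (mult_adj u) = mult_one}"

definition central_multipliers :: "'a::cstar_algebra double_map set" where
  "central_multipliers = {m \<in> multipliers. \<forall>n\<in>multipliers. mult_prod m n = mult_prod n m}"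

text \<open>The extension of an automorphism to the multiplier algebra.\<close>

definition mult_ext :: "('a \<Rightarrow> 'a) \<Rightarrow> 'a double_map \<Rightarrow> 'a double_map" where
  "mult_ext \<phi> m = (\<lambda>a. \<phi> (left_act m (inv \<phi> a)), \<lambda>a. \<phi> (right_act (inv \<phi> a) m))"

locale twisted_cstar_system =
  fixes \<alpha> :: "'g::group_add \<Rightarrow> 'a::cstar_algebra \<Rightarrow> 'a"
    and \<omega> :: "'g \<Rightarrow> 'g \<Rightarrow> 'a double_map"
  assumes automorphism: "star_automorphism (\<alpha> x)"
    and unitary: "\<omega> x y \<in> unitary_multipliers"
    and central: "\<omega> x y \<in> central_multipliers"
    and action: "\<alpha> x \<circ> \<alpha> y = \<alpha> (x + y)"
    and cocycle: "mult_prod (\<omega> x y) (\<omega> (x + y) z) =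
                  mult_prod (mult_ext (\<alpha> x) (\<omega> y z)) (\<omega> x (y + z))"
    and normalized_right: "\<omega> x 0 = mult_one"
    and normalized_left: "\<omega> 0 x = mult_one"

section \<open>Banach *-algebras of functions\<close>

text \<open>
  Additive structure is that of the ambient type; below this is the pointwise one of functions.
\<close>

record 'v star_algebra =
  carrier :: "'v set"
  smul :: "complex \<Rightarrow> 'v \<Rightarrow> 'v"
  mul :: "'v \<Rightarrow> 'v \<Rightarrow> 'v"
  invol :: "'v \<Rightarrow> 'v"
  nrm :: "'v \<Rightarrow> real"

locale banach_star_algebra =
  fixes S :: "'v::ab_group_add star_algebra"
  assumes zero_closed: "0 \<in> carrier S"
    and add_closed: "\<lbrakk>u \<in> carrier S; v \<in> carrier S\<rbrakk> \<Longrightarrow> u + v \<in> carrier S"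
    and smul_closed: "u \<in> carrier S \<Longrightarrow> smul S c u \<in> carrier S"
    and mul_closed: "\<lbrakk>u \<in> carrier S; v \<in> carrier S\<rbrakk> \<Longrightarrow> mul S u v \<in> carrier S"
    and invol_closed: "u \<in> carrier S \<Longrightarrow> invol S u \<in> carrier S"
    and smul_add_right: "\<lbrakk>u \<in> carrier S; v \<in> carrier S\<rbrakk> \<Longrightarrow> smul S c (u + v) = smul S c u + smul S c v"
    and smul_add_left: "u \<in> carrier S \<Longrightarrow> smul S (c + d) u = smul S c u + smul S d u"
    and smul_smul: "u \<in> carrier S \<Longrightarrow> smul S c (smul S d u) = smul S (c * d) u"
    and smul_one: "u \<in> carrier S \<Longrightarrow> smul S 1 u = u"
    and mul_assoc: "\<lbrakk>u \<in> carrier S; v \<in> carrier S; w \<in> carrier S\<rbrakk> \<Longrightarrow>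
      mul S (mul S u v) w = mul S u (mul S v w)"
    and mul_add_left: "\<lbrakk>u \<in> carrier S; v \<in> carrier S; w \<in> carrier S\<rbrakk> \<Longrightarrow>
      mul S (u + v) w = mul S u w + mul S v w"
    and mul_add_right: "\<lbrakk>u \<in> carrier S; v \<in> carrier S; w \<in> carrier S\<rbrakk> \<Longrightarrow>
      mul S u (v + w) = mul S u v + mul S u w"
    and mul_smul_left: "\<lbrakk>u \<in> carrier S; v \<in> carrier S\<rbrakk> \<Longrightarrow> mul S (smul S c u) v = smul S c (mul S u v)"
    and mul_smul_right: "\<lbrakk>u \<in> carrier S; v \<in> carrier S\<rbrakk> \<Longrightarrow> mul S u (smul S c v) = smul S c (mul S u v)"
    and invol_invol: "u \<in> carrier S \<Longrightarrow> invol S (invol S u) = u"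
    and invol_add: "\<lbrakk>u \<in> carrier S; v \<in> carrier S\<rbrakk> \<Longrightarrow> invol S (u + v) = invol S u + invol S v"
    and invol_smul: "u \<in> carrier S \<Longrightarrow> invol S (smul S c u) = smul S (cnj c) (invol S u)"
    and invol_mul: "\<lbrakk>u \<in> carrier S; v \<in> carrier S\<rbrakk> \<Longrightarrow>
      invol S (mul S u v) = mul S (invol S v) (invol S u)"
    and nrm_nonneg: "u \<in> carrier S \<Longrightarrow> 0 \<le> nrm S u"
    and nrm_eq_zero: "u \<in> carrier S \<Longrightarrow> nrm S u = 0 \<longleftrightarrow> u = 0"
    and nrm_add: "\<lbrakk>u \<in> carrier S; v \<in> carrier S\<rbrakk> \<Longrightarrow> nrm S (u + v) \<le> nrm S u + nrm S v"
    and nrm_smul: "u \<in> carrier S \<Longrightarrow> nrm S (smul S c u) = cmod c * nrm S u"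
    and nrm_mul: "\<lbrakk>u \<in> carrier S; v \<in> carrier S\<rbrakk> \<Longrightarrow> nrm S (mul S u v) \<le> nrm S u * nrm S v"
    and nrm_invol: "u \<in> carrier S \<Longrightarrow> nrm S (invol S u) = nrm S u"
    and nrm_complete: "\<lbrakk>\<And>n. X n \<in> carrier S;
        \<And>e. e > 0 \<Longrightarrow> \<exists>M::nat. \<forall>m\<ge>M. \<forall>n\<ge>M. nrm S (X m - X n) < e\<rbrakk> \<Longrightarrow>
      \<exists>u\<in>carrier S. (\<lambda>n. nrm S (X n - u)) \<longlonglongrightarrow> 0"

definition has_unit :: "'v star_algebra \<Rightarrow> bool" where
  "has_unit S \<longleftrightarrow> (\<exists>e\<in>carrier S. \<forall>u\<in>carrier S. mul S e u = u \<and> mul S u e = u)"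

definition isometric_star_morphism ::
  "'v::ab_group_add star_algebra \<Rightarrow> 'w::ab_group_add star_algebra \<Rightarrow> ('v \<Rightarrow> 'w) \<Rightarrow> bool" where
  "isometric_star_morphism S T \<Phi> \<longleftrightarrow>
     (\<forall>u\<in>carrier S. \<Phi> u \<in> carrier T) \<and>
     (\<forall>u\<in>carrier S. \<forall>v\<in>carrier S. \<Phi> (u + v) = \<Phi> u + \<Phi> v) \<and>
     (\<forall>c. \<forall>u\<in>carrier S. \<Phi> (smul S c u) = smul T c (\<Phi> u)) \<and>
     (\<forall>u\<in>carrier S. \<forall>v\<in>carrier S. \<Phi> (mul S u v) = mul T (\<Phi> u) (\<Phi> v)) \<and>
     (\<forall>u\<in>carrier S. \<Phi> (invol S u) = invol T (\<Phi> u)) \<and>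
     (\<forall>u\<in>carrier S. nrm T (\<Phi> u) = nrm S u)"

section \<open>Admissible algebras\<close>

definition l1 :: "('g \<Rightarrow> 'b::real_normed_vector) set" where
  "l1 = {f. f abs_summable_on UNIV}"

definition conv :: "('g::group_add \<Rightarrow> complex) \<Rightarrow> ('g \<Rightarrow> complex) \<Rightarrow> 'g \<Rightarrow> complex" where
  "conv k l = (\<lambda>x. \<Sum>\<^sub>\<infinity>y. k y * l (- y + x))"

definition conv_adj :: "('g::group_add \<Rightarrow> complex) \<Rightarrow> 'g \<Rightarrow> complex" where
  "conv_adj k = (\<lambda>x. cnj (k (- x)))"

definition conv_algebra ::
  "('g::group_add \<Rightarrow> complex) set \<Rightarrow> (('g \<Rightarrow> complex) \<Rightarrow> real) \<Rightarrow> ('g \<Rightarrow> complex) star_algebra" where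
  "conv_algebra \<L> N =
     \<lparr>carrier = \<L>, smul = (\<lambda>c k x. c * k x), mul = conv, invol = conv_adj, nrm = N\<rparr>"

locale admissible_algebra =
  fixes \<L> :: "('g::group_add \<Rightarrow> complex) set" and N :: "('g \<Rightarrow> complex) \<Rightarrow> real"
  assumes subset_l1: "\<L> \<subseteq> l1"
    and stronger_than_l1: "\<exists>C. \<forall>k\<in>\<L>. (\<Sum>\<^sub>\<infinity>x. cmod (k x)) \<le> C * N k"
    and solid: "\<lbrakk>\<And>x. cmod (k x) \<le> cmod (l x); l \<in> \<L>\<rbrakk> \<Longrightarrow> k \<in> \<L> \<and> N k \<le> N l"
    and banach: "banach_star_algebra (conv_algebra \<L> N)"
    and unital: "has_unit (conv_algebra \<L> N)"

section \<open>The twisted convolution algebra and the kernel algebra\<close>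

definition twisted_conv_algebra ::
  "('g::group_add \<Rightarrow> 'a::cstar_algebra \<Rightarrow> 'a) \<Rightarrow> ('g \<Rightarrow> 'g \<Rightarrow> 'a double_map) \<Rightarrow>
   ('g \<Rightarrow> complex) set \<Rightarrow> (('g \<Rightarrow> complex) \<Rightarrow> real) \<Rightarrow> ('g \<Rightarrow> 'a) star_algebra" where
  "twisted_conv_algebra \<alpha> \<omega> \<L> N =
     \<lparr>carrier = {f \<in> l1. (\<lambda>x. complex_of_real (norm (f x))) \<in> \<L>},
      smul = (\<lambda>c f x. c *\<^sub>C f x),
      mul = (\<lambda>f g x. \<Sum>\<^sub>\<infinity>y. right_act (f y * \<alpha> y (g (- y + x))) (\<omega> y (- y + x))),
      invol = (\<lambda>f x. left_act (mult_adj (\<omega> x (- x))) (adj (\<alpha> x (f (- x))))),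
      nrm = (\<lambda>f. N (\<lambda>x. complex_of_real (norm (f x))))\<rparr>"

definition dominating ::
  "('g::group_add \<Rightarrow> complex) set \<Rightarrow> ('g \<Rightarrow> 'g \<Rightarrow> 'a::cstar_algebra) \<Rightarrow> ('g \<Rightarrow> complex) set" where
  "dominating \<L> K = {k \<in> \<L>. \<forall>x y. norm (K x y) \<le> cmod (k (x - y))}"

definition kernel_algebra ::
  "('g::group_add \<Rightarrow> 'a::cstar_algebra \<Rightarrow> 'a) \<Rightarrow> ('g \<Rightarrow> 'g \<Rightarrow> 'a double_map) \<Rightarrow>
   ('g \<Rightarrow> complex) set \<Rightarrow> (('g \<Rightarrow> complex) \<Rightarrow> real) \<Rightarrow> ('g \<Rightarrow> 'g \<Rightarrow> 'a) star_algebra" where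
  "kernel_algebra \<alpha> \<omega> \<L> N =
     \<lparr>carrier = {K. dominating \<L> K \<noteq> {}},
      smul = (\<lambda>c K x y. c *\<^sub>C K x y),
      mul = (\<lambda>K L x y. \<Sum>\<^sub>\<infinity>z. right_act (K x z * L z y) (mult_ext (\<alpha> (- x)) (\<omega> (x - z) (z - y)))),
      invol = (\<lambda>K x y.
        left_act (mult_ext (\<alpha> (- x)) (mult_adj (\<omega> (x - y) (y - x)))) (adj (K y x))),
      nrm = (\<lambda>K. INF k\<in>dominating \<L> K. N k)\<rparr>"

definition covariant_kernels ::
  "('g::group_add \<Rightarrow> 'a::cstar_algebra \<Rightarrow> 'a) \<Rightarrow> ('g \<Rightarrow> 'g \<Rightarrow> 'a double_map) \<Rightarrow>
   ('g \<Rightarrow> complex) set \<Rightarrow> (('g \<Rightarrow> complex) \<Rightarrow> real) \<Rightarrow> ('g \<Rightarrow> 'g \<Rightarrow> 'a) set" where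
  "covariant_kernels \<alpha> \<omega> \<L> N =
     {K \<in> carrier (kernel_algebra \<alpha> \<omega> \<L> N). \<forall>x y z. K (x + z) (y + z) = \<alpha> (- z) (K x y)}"

definition Gam :: "('g::group_add \<Rightarrow> 'a \<Rightarrow> 'a) \<Rightarrow> ('g \<Rightarrow> 'a) \<Rightarrow> 'g \<Rightarrow> 'g \<Rightarrow> 'a" where
  "Gam \<alpha> f = (\<lambda>x y. \<alpha> (- x) (f (x - y)))"

end

theory Submission
  imports Defs
begin

text \<open>
  Pointwise, \<open>Gam \<alpha>\<close> only applies automorphisms, so most of the theorem is bookkeeping in the
  group: the substitution \<open>z = - w + x\<close> turns the twisted convolution into the composition of
  kernels, and the covariance relation lets a kernel be recovered from its values \<open>K x 0\<close>. The
  analytic input is that an automorphism of a C*-algebra is isometric by its algebraic properties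
  alone (\<open>star_automorphism_norm\<close>). It lets automorphisms pass through infinite sums, and it makes
  \<open>norm \<circ> f\<close> a dominating function for \<open>Gam \<alpha> f\<close>. Every dominating function is at least
  \<open>norm \<circ> f\<close> already because of the column \<open>y = 0\<close>, so by solidity \<open>norm \<circ> f\<close> has the least
  norm among them, and \<open>Gam \<alpha>\<close> is isometric.

  Isometry of automorphisms is proved without spectral theory and without adjoining a unit. A
  self-adjoint \<open>h\<close> with \<open>norm h < 1\<close> is the real part of the unitary
  \<open>h + \<i> \<cdot> sqrt (1 - h\<^sup>2)\<close> of the unitization. Writing the square root as \<open>1 - s\<close>, with \<open>s\<close> in
  the algebra itself, the unitarity of this element amounts to the identity \<open>h\<^sup>2 = 2 s - s\<^sup>2\<close>
  between commuting self-adjoint elements, which survives any *-homomorphism. Unitarity bounds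
  left multiplication by the image of \<open>h\<close> by \<open>1\<close>. The element \<open>s\<close> is the fixed point of the
  contraction \<open>s \<mapsto> (h\<^sup>2 + s\<^sup>2) / 2\<close>.
\<close>

section \<open>Automorphisms of C*-algebras are isometric\<close>

lemma adj_scaleR: "adj (r *\<^sub>R (a::'a::cstar_algebra)) = r *\<^sub>R adj a"
  by (simp add: scaleR_scaleC adj_scaleC)

lemma norm_adj: "norm (adj (a::'a::cstar_algebra)) = norm a"
proof -
  have *: "norm b \<le> norm (adj b)" for b :: 'a
  proof (cases "b = 0")
    case False
    have "norm b * norm b = norm (adj b * b)"
      by (simp add: cstar_identity power2_eq_square)
    also have "\<dots> \<le> norm (adj b) * norm b" by (rule norm_mult_ineq)
    finally show ?thesis using False by simp
  qed simp
  show ?thesis using *[of a] *[of "adj a"] by (simp add: adj_adj)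
qed

lemma bounded_linear_adj: "bounded_linear (adj :: 'a::cstar_algebra \<Rightarrow> 'a)"
  by (rule bounded_linear_intro[where K = 1]) (simp_all add: adj_add adj_scaleR norm_adj)

lemma adj_diff: "adj (a - b :: 'a::cstar_algebra) = adj a - adj b"
  by (rule linear_diff[OF bounded_linear.linear[OF bounded_linear_adj]])

lemma scaleC_diff_right: "c *\<^sub>C (a - b :: 'a::cstar_algebra) = c *\<^sub>C a - c *\<^sub>C b"
  using scaleC_add_right[of c "a - b" b] by (simp add: algebra_simps)

lemma scaleC_minus_left: "(- c) *\<^sub>C (a :: 'a::cstar_algebra) = - (c *\<^sub>C a)"
proof -
  have "(- c) *\<^sub>C a + c *\<^sub>C a = 0 *\<^sub>C a"
    by (simp flip: scaleC_add_left)
  also have "\<dots> = 0" using norm_scaleC[of 0 a] by simp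
  finally show ?thesis by (simp add: eq_neg_iff_add_eq_0)
qed

text \<open>
  The map \<open>s \<mapsto> (h\<^sup>2 + s\<^sup>2) / 2\<close> preserves the ball of radius \<open>norm h\<close> because
  \<open>(r\<^sup>2 + r\<^sup>2) / 2 \<le> r\<close> for \<open>r \<le> 1\<close>, and it contracts it by the factor \<open>norm h\<close>. Self-adjointness
  and commutation with \<open>h\<close> are closed conditions that it preserves, so the fixed point inherits them.
\<close>

lemma one_minus_sqrt_exists:
  fixes h :: "'a::cstar_algebra"
  assumes sa: "adj h = h" and lt: "norm h < 1"
  obtains s where "adj s = s" "s * h = h * s" "h * h = s + s - s * s"
proof -
  define S where "S = {s. adj s = s \<and> s * h = h * s \<and> norm s \<le> norm h}"
  define F where "F s = (1/2) *\<^sub>R (h * h + s * s)" for s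
  have "closed S" unfolding S_def
    by (intro closed_Collect_conj closed_Collect_eq closed_Collect_le
        bounded_linear.continuous_on[OF bounded_linear_adj] continuous_intros)
  then have "complete S" by (simp add: complete_eq_closed)
  moreover have "S \<noteq> {}" using sa by (auto simp: S_def)
  moreover have "F ` S \<subseteq> S"
  proof (clarify)
    fix s assume "s \<in> S"
    then have s: "adj s = s" "s * h = h * s" "norm s \<le> norm h" by (auto simp: S_def)
    have hs: "norm (h * h) \<le> norm h" "norm (s * s) \<le> norm h"
      using norm_mult_ineq[of h h] norm_mult_ineq[of s s] s(3) lt
        mult_mono[of "norm h" 1 "norm h" "norm h"] mult_mono[of "norm s" 1 "norm s" "norm h"]
      by auto
    have "norm (h * h + s * s) \<le> 2 * norm h" using norm_triangle_ineq[of "h * h" "s * s"] hs by simp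
    then have "norm (F s) \<le> norm h" by (simp add: F_def)
    moreover have "s * s * h = h * (s * s)" using s(2) by (metis mult.assoc)
    then have "F s * h = h * F s" by (simp add: F_def algebra_simps)
    moreover have "adj (F s) = F s" by (simp add: F_def adj_scaleR adj_add adj_mult sa s)
    ultimately show "F s \<in> S" by (simp add: S_def)
  qed
  moreover have "dist (F s) (F t) \<le> norm h * dist s t" if "s \<in> S" "t \<in> S" for s t
  proof -
    have "F s - F t = (1/2) *\<^sub>R (s * (s - t) + (s - t) * t)"
      by (simp add: F_def algebra_simps)
    also have "norm \<dots> \<le> (1/2) * (norm s * norm (s - t) + norm (s - t) * norm t)"
      using norm_triangle_le[OF add_mono[OF norm_mult_ineq[of s "s - t"] norm_mult_ineq[of "s - t" t]]]
      by simp
    also have "\<dots> \<le> (1/2) * (norm h * norm (s - t) + norm (s - t) * norm h)"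
      using that by (intro mult_left_mono add_mono mult_right_mono) (auto simp: S_def mult_left_mono)
    finally show ?thesis by (simp add: dist_norm mult.commute)
  qed
  ultimately have "\<exists>!s\<in>S. F s = s" using lt by (intro Banach_fix[of S "norm h"]) auto
  then obtain s where s: "s \<in> S" "F s = s" by blast
  have "s + s = 2 *\<^sub>R F s" using s(2) by (simp add: scaleR_2)
  also have "\<dots> = h * h + s * s" by (simp add: F_def)
  finally have "h * h = s + s - s * s" by simp
  then show thesis using that s(1) by (auto simp: S_def)
qed

text \<open>
  The hypotheses say that \<open>b \<plusminus> \<i> (1 - t)\<close> are unitaries of the unitization. They act isometrically
  by left multiplication, and \<open>b\<close> is their mean.
\<close>

lemma norm_mult_le_if_real_part_of_unitary:
  fixes b t x :: "'a::cstar_algebra"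
  assumes sa: "adj b = b" "adj t = t" and comm: "t * b = b * t"
    and sq: "b * b = t + t - t * t"
  shows "norm (b * x) \<le> norm x"
proof -
  \<comment> \<open>The conditions on \<open>\<epsilon>\<close> hold for \<open>\<i>\<close> and \<open>- \<i>\<close>, so one computation covers both unitaries.\<close>
  have iso: "norm (b * x + \<epsilon> *\<^sub>C (x - t * x)) = norm x" if \<epsilon>: "cnj \<epsilon> = - \<epsilon>" "\<epsilon> * \<epsilon> = - 1" for \<epsilon>
  proof -
    define c where "c = x - t * x"
    let ?u = "b * x + \<epsilon> *\<^sub>C c"
    have c': "adj c = adj x - adj x * t" by (simp add: c_def adj_diff adj_mult sa)
    have one: "1 *\<^sub>C y = y" for y :: 'a using scaleR_scaleC[of 1 y] by simp
    have "adj ?u * ?u = (adj x * b - \<epsilon> *\<^sub>C adj c) * (b * x + \<epsilon> *\<^sub>C c)"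
      by (simp add: adj_add adj_mult adj_scaleC sa \<epsilon> scaleC_minus_left)
    also have "\<dots> = adj x * (b * b) * x + adj c * c + \<epsilon> *\<^sub>C (adj x * b * c - adj c * b * x)"
      by (simp add: distrib_left left_diff_distrib mult_scaleC_left mult_scaleC_right
          scaleC_scaleC \<epsilon>(2) scaleC_minus_left one scaleC_diff_right mult.assoc)
    also have "adj x * b * c - adj c * b * x = adj x * (t * b - b * t) * x"
      by (simp add: c_def[symmetric] c') (simp add: c_def algebra_simps)
    also have "\<dots> = 0" by (simp add: comm)
    also have "adj x * (b * b) * x + adj c * c = adj x * x"
      unfolding c' sq by (simp add: c_def algebra_simps)
    also have "\<epsilon> *\<^sub>C (0::'a) = 0" using norm_scaleC[of \<epsilon> "0::'a"] by simp
    finally have "adj ?u * ?u = adj x * x" by simp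
    then have "(norm ?u)\<^sup>2 = (norm x)\<^sup>2" by (simp flip: cstar_identity)
    then show ?thesis by (simp add: c_def)
  qed
  let ?c = "x - t * x"
  have "2 *\<^sub>R (b * x) = (b * x + \<i> *\<^sub>C ?c) + (b * x + (- \<i>) *\<^sub>C ?c)"
    by (simp add: scaleC_minus_left scaleR_2)
  then have "norm (2 *\<^sub>R (b * x)) \<le> norm (b * x + \<i> *\<^sub>C ?c) + norm (b * x + (- \<i>) *\<^sub>C ?c)"
    by (metis norm_triangle_ineq)
  also have "\<dots> = 2 * norm x" using iso[of \<i>] iso[of "- \<i>"] by simp
  finally show ?thesis by simp
qed

lemma star_automorphismD:
  assumes "star_automorphism \<phi>"
  shows "bij \<phi>" "\<phi> (a + b) = \<phi> a + \<phi> b" "\<phi> (c *\<^sub>C a) = c *\<^sub>C \<phi> a"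
    "\<phi> (a * b) = \<phi> a * \<phi> b" "\<phi> (adj a) = adj (\<phi> a)"
    "\<phi> (r *\<^sub>R a) = r *\<^sub>R \<phi> a" "\<phi> (a - b) = \<phi> a - \<phi> b" "\<phi> 0 = 0"
proof -
  show *: "bij \<phi>" "\<phi> (a + b) = \<phi> a + \<phi> b" "\<phi> (c *\<^sub>C a) = c *\<^sub>C \<phi> a"
    "\<phi> (a * b) = \<phi> a * \<phi> b" "\<phi> (adj a) = adj (\<phi> a)" for a b c
    using assms by (auto simp: star_automorphism_def)
  show "\<phi> (r *\<^sub>R a) = r *\<^sub>R \<phi> a" by (simp add: * scaleR_scaleC)
  show "\<phi> (a - b) = \<phi> a - \<phi> b" using *(2)[of "a - b" b] by (simp add: algebra_simps)
  show "\<phi> 0 = 0" using *(2)[of 0 0] by simp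
qed

lemma star_automorphism_inv:
  assumes "star_automorphism \<phi>"
  shows "star_automorphism (inv \<phi>)"
proof -
  note D = star_automorphismD[OF assms]
  have [simp]: "\<phi> (inv \<phi> a) = a" "inv \<phi> (\<phi> a) = a" for a
    using D(1) by (simp_all add: bij_is_surj surj_f_inv_f bij_is_inj)
  have *: "inv \<phi> a = b \<longleftrightarrow> a = \<phi> b" for a b by auto
  show ?thesis unfolding star_automorphism_def by (simp add: * D(2-5) bij_imp_bij_inv D(1))
qed

text \<open>
  After normalisation a self-adjoint \<open>h\<close> is the real part of a unitary, and so is its image \<open>\<phi> h\<close>;
  the C*-identity reduces a general element \<open>a\<close> to \<open>adj a * a\<close>.
\<close>

lemma star_automorphism_norm_le:
  assumes "star_automorphism \<phi>"
  shows "norm (\<phi> a) \<le> norm a"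
proof -
  note D = star_automorphismD[OF assms]
  have unit: "norm (\<phi> h) \<le> 1" if h: "adj h = h" "norm h < 1" for h
  proof -
    obtain s where s: "adj s = s" "s * h = h * s" "h * h = s + s - s * s"
      using one_minus_sqrt_exists[OF h] .
    have "norm (\<phi> h * x) \<le> norm x" for x
      by (rule norm_mult_le_if_real_part_of_unitary[of _ "\<phi> s"])
        (simp_all add: h(1) s flip: D(2,4,5,7))
    from this[of "\<phi> h"] have "(norm (\<phi> h))\<^sup>2 \<le> norm (\<phi> h)"
      using cstar_identity[of "\<phi> h"] by (simp add: h(1) flip: D(5))
    then show ?thesis by (cases "\<phi> h = 0") (simp_all add: power2_eq_square)
  qed
  have sa: "norm (\<phi> h) \<le> norm h" if h: "adj h = h" for h
  proof (rule dense_ge)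
    fix r assume r: "norm h < r"
    then have "r > 0" using norm_ge_zero[of h] by linarith
    then have "norm (\<phi> ((1/r) *\<^sub>R h)) \<le> 1" using r by (intro unit) (simp_all add: adj_scaleR h)
    then show "norm (\<phi> h) \<le> r" using \<open>r > 0\<close> by (simp add: D(6) field_simps)
  qed
  have "(norm (\<phi> a))\<^sup>2 = norm (\<phi> (adj a * a))" by (simp add: D(4,5) cstar_identity)
  also have "\<dots> \<le> norm (adj a * a)" by (rule sa) (simp add: adj_mult adj_adj)
  finally show ?thesis by (simp add: cstar_identity)
qed

lemma star_automorphism_norm:
  assumes "star_automorphism \<phi>"
  shows "norm (\<phi> a) = norm a"
  using star_automorphism_norm_le[OF assms, of a]
    star_automorphism_norm_le[OF star_automorphism_inv[OF assms], of "\<phi> a"]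
    star_automorphismD(1)[OF assms]
  by (simp add: bij_is_inj)

lemma star_automorphism_bounded_linear:
  assumes "star_automorphism \<phi>"
  shows "bounded_linear \<phi>"
  by (rule bounded_linear_intro[where K = 1])
    (simp_all add: star_automorphismD[OF assms] star_automorphism_norm[OF assms])

text \<open>
  Because the inverse is continuous as well, a family is summable exactly when its image is, and
  for a family that is not summable both sides are \<open>0\<close>.
\<close>

lemma star_automorphism_infsum:
  assumes "star_automorphism \<phi>"
  shows "\<phi> (\<Sum>\<^sub>\<infinity>x\<in>A. f x) = (\<Sum>\<^sub>\<infinity>x\<in>A. \<phi> (f x))"
proof -
  note inv = star_automorphism_inv[OF assms]
  have "(\<lambda>x. \<phi> (f x)) summable_on A \<longleftrightarrow> f summable_on A"
    using star_automorphismD(1)[OF assms]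
    by (intro summable_on_bounded_linear_iff[where h' = "inv \<phi>"]
        star_automorphism_bounded_linear assms inv) (simp add: bij_is_inj)
  then show ?thesis
    by (rule infsum_bounded_linear_strong[OF _ star_automorphism_bounded_linear[OF assms], symmetric])
qed

section \<open>The action of the group\<close>

context twisted_cstar_system
begin

lemmas \<alpha>_simps = star_automorphismD[OF automorphism]

lemmas group_simps = diff_conv_add_uminus add.assoc minus_add minus_minus left_minus right_minus
  add_0_left add_0_right minus_add_cancel add_minus_cancel

lemma \<alpha>_\<alpha>: "\<alpha> x (\<alpha> y a) = \<alpha> (x + y) a"
  using action[of x y] by (metis comp_apply)

lemma \<alpha>_zero: "\<alpha> 0 a = a"
proof -
  have "\<alpha> 0 (\<alpha> 0 a) = \<alpha> 0 a" by (simp add: \<alpha>_\<alpha>)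
  then show ?thesis using \<alpha>_simps(1)[of 0] by (metis bij_is_inj inj_eq)
qed

lemma norm_\<alpha>: "norm (\<alpha> x a) = norm a"
  by (rule star_automorphism_norm[OF automorphism])

lemma inv_\<alpha>: "inv (\<alpha> x) a = \<alpha> (- x) a"
  using \<alpha>_simps(1)[of x] by (simp add: bij_is_inj inv_f_eq \<alpha>_\<alpha> \<alpha>_zero)

section \<open>The map on kernels\<close>

lemma norm_Gam: "norm (Gam \<alpha> f x y) = norm (f (x - y))"
  by (simp add: Gam_def norm_\<alpha>)

text \<open>
  The twist of the kernel composition is the image of the twist of the convolution under
  \<open>\<alpha> (- x)\<close>, so the two sums agree term by term once the group element \<open>w\<close> of the convolution
  is expressed as \<open>x - z\<close>.
\<close>

lemma Gam_mul:
  "Gam \<alpha> (mul (twisted_conv_algebra \<alpha> \<omega> \<L> N) f g) =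
    mul (kernel_algebra \<alpha> \<omega> \<L> N) (Gam \<alpha> f) (Gam \<alpha> g)"
proof (intro ext)
  fix x y
  define T where "T w = \<alpha> (- x) (right_act (f w * \<alpha> w (g (- w + (x - y)))) (\<omega> w (- w + (x - y))))"
    for w
  have bij: "bij_betw (\<lambda>z. x - z) UNIV UNIV"
    by (rule bij_betw_byWitness[where f' = "\<lambda>w. - w + x"]) (simp_all only: group_simps subset_UNIV ball_UNIV simp_thms)
  have "Gam \<alpha> (mul (twisted_conv_algebra \<alpha> \<omega> \<L> N) f g) x y = (\<Sum>\<^sub>\<infinity>w. T w)"
    by (simp add: Gam_def twisted_conv_algebra_def T_def star_automorphism_infsum[OF automorphism])
  also have "\<dots> = (\<Sum>\<^sub>\<infinity>z. T (x - z))" by (rule infsum_reindex_bij_betw[OF bij, symmetric])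
  also have "\<dots> = mul (kernel_algebra \<alpha> \<omega> \<L> N) (Gam \<alpha> f) (Gam \<alpha> g) x y"
  proof -
    have shift: "z - x + (x - y) = z - y" "- x + (x - z) = - z" for z
      by (simp_all only: group_simps)
    show ?thesis
      by (simp add: kernel_algebra_def Gam_def T_def shift mult_ext_def inv_\<alpha> \<alpha>_simps(4) \<alpha>_\<alpha> \<alpha>_zero)
  qed
  finally show "Gam \<alpha> (mul (twisted_conv_algebra \<alpha> \<omega> \<L> N) f g) x y =
    mul (kernel_algebra \<alpha> \<omega> \<L> N) (Gam \<alpha> f) (Gam \<alpha> g) x y" .
qed

lemma Gam_invol:
  "Gam \<alpha> (invol (twisted_conv_algebra \<alpha> \<omega> \<L> N) f) =
    invol (kernel_algebra \<alpha> \<omega> \<L> N) (Gam \<alpha> f)"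
proof (intro ext)
  fix x y :: 'g
  have "x + - y = x - y" "x + (- y + a) = x - y + a" for a :: 'g
    by (simp_all only: group_simps)
  then show "Gam \<alpha> (invol (twisted_conv_algebra \<alpha> \<omega> \<L> N) f) x y =
    invol (kernel_algebra \<alpha> \<omega> \<L> N) (Gam \<alpha> f) x y"
    by (simp add: Gam_def twisted_conv_algebra_def kernel_algebra_def mult_ext_def inv_\<alpha> \<alpha>_\<alpha>
        flip: \<alpha>_simps(5))
qed

lemma Gam_covariant: "Gam \<alpha> f (x + z) (y + z) = \<alpha> (- z) (Gam \<alpha> f x y)"
proof -
  have "x + z - (y + z) = x - y" "- (x + z) = - z + - x" by (simp_all only: group_simps)
  then show ?thesis by (simp only: Gam_def \<alpha>_\<alpha>)
qed

lemma Gam_left_inverse: "\<alpha> x (Gam \<alpha> f x 0) = f x"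
  by (simp add: Gam_def \<alpha>_\<alpha> \<alpha>_zero)

text \<open>Covariance with \<open>z = y\<close> expresses \<open>K x y\<close> by the value of \<open>K\<close> at \<open>(x - y, 0)\<close>.\<close>

lemma Gam_right_inverse:
  fixes K :: "'g \<Rightarrow> 'g \<Rightarrow> 'a"
  assumes "\<And>x y z. K (x + z) (y + z) = \<alpha> (- z) (K x y)"
  shows "Gam \<alpha> (\<lambda>x. \<alpha> x (K x 0)) = K"
proof (intro ext)
  fix x y :: 'g
  have "- x + (x - y) = - y" by (simp only: group_simps)
  then show "Gam \<alpha> (\<lambda>x. \<alpha> x (K x 0)) x y = K x y"
    using assms[of "x - y" y 0] by (simp add: Gam_def \<alpha>_\<alpha>)
qed

context
  fixes \<L> :: "('g \<Rightarrow> complex) set" and N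
  assumes admissible: "admissible_algebra \<L> N"
begin

lemma norm_in_dominating_Gam:
  assumes "f \<in> carrier (twisted_conv_algebra \<alpha> \<omega> \<L> N)"
  shows "(\<lambda>x. complex_of_real (norm (f x))) \<in> dominating \<L> (Gam \<alpha> f)"
  using assms by (simp add: dominating_def twisted_conv_algebra_def norm_Gam)

text \<open>
  The infimum defining the kernel norm is a minimum: on the column \<open>y = 0\<close> the domination
  condition reads \<open>norm (f x) \<le> cmod (k x)\<close>, and solidity compares the norms.
\<close>

lemma nrm_Gam:
  assumes "f \<in> carrier (twisted_conv_algebra \<alpha> \<omega> \<L> N)"
  shows "nrm (kernel_algebra \<alpha> \<omega> \<L> N) (Gam \<alpha> f) = nrm (twisted_conv_algebra \<alpha> \<omega> \<L> N) f"
proof -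
  let ?n = "\<lambda>x. complex_of_real (norm (f x))"
  have "N ?n \<le> N k" if "k \<in> dominating \<L> (Gam \<alpha> f)" for k
  proof -
    have "k \<in> \<L>" and k: "\<And>x y. norm (f (x - y)) \<le> cmod (k (x - y))"
      using that by (auto simp: dominating_def norm_Gam)
    moreover have "cmod (?n x) \<le> cmod (k x)" for x using k[of x 0] by simp
    ultimately show ?thesis using admissible_algebra.solid[OF admissible, of ?n k] by blast
  qed
  then have "Inf (N ` dominating \<L> (Gam \<alpha> f)) = N ?n"
    using norm_in_dominating_Gam[OF assms] by (intro cInf_eq_minimum) auto
  then show ?thesis by (simp add: kernel_algebra_def twisted_conv_algebra_def)
qed

text \<open>
  Membership is a matter of size only, and \<open>norm (K x 0) \<le> cmod (k x)\<close> for any dominating \<open>k\<close>;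
  solidity puts the left side into \<open>\<L>\<close>, hence into \<open>l1\<close>.
\<close>

lemma kernel_column_in_carrier:
  assumes "K \<in> carrier (kernel_algebra \<alpha> \<omega> \<L> N)"
  shows "(\<lambda>x. \<alpha> x (K x 0)) \<in> carrier (twisted_conv_algebra \<alpha> \<omega> \<L> N)"
proof -
  from assms obtain k where k: "k \<in> \<L>" "\<And>x y. norm (K x y) \<le> cmod (k (x - y))"
    by (auto simp: kernel_algebra_def dominating_def)
  have "cmod (complex_of_real (norm (\<alpha> x (K x 0)))) \<le> cmod (k x)" for x
    using k(2)[of x 0] by (simp add: norm_\<alpha>)
  then have mem: "(\<lambda>x. complex_of_real (norm (\<alpha> x (K x 0)))) \<in> \<L>"
    using k(1) by (rule conjunct1[OF admissible_algebra.solid[OF admissible]])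
  then have "(\<lambda>x. complex_of_real (norm (\<alpha> x (K x 0)))) \<in> l1"
    by (rule subsetD[OF admissible_algebra.subset_l1[OF admissible]])
  then have "(\<lambda>x. \<alpha> x (K x 0)) \<in> l1" by (simp add: l1_def)
  with mem show ?thesis by (simp add: twisted_conv_algebra_def)
qed

lemma Gam_isometric_star_morphism:
  "isometric_star_morphism
    (twisted_conv_algebra \<alpha> \<omega> \<L> N) (kernel_algebra \<alpha> \<omega> \<L> N) (Gam \<alpha>)"
  unfolding isometric_star_morphism_def
proof (intro conjI ballI allI)
  fix f assume f: "f \<in> carrier (twisted_conv_algebra \<alpha> \<omega> \<L> N)"
  show "Gam \<alpha> f \<in> carrier (kernel_algebra \<alpha> \<omega> \<L> N)"
    using norm_in_dominating_Gam[OF f] by (auto simp: kernel_algebra_def)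
  show "Gam \<alpha> (smul (twisted_conv_algebra \<alpha> \<omega> \<L> N) c f) =
    smul (kernel_algebra \<alpha> \<omega> \<L> N) c (Gam \<alpha> f)" for c
    by (simp add: Gam_def twisted_conv_algebra_def kernel_algebra_def \<alpha>_simps(3))
  show "Gam \<alpha> (f + g) = Gam \<alpha> f + Gam \<alpha> g" for g
    by (simp add: Gam_def fun_eq_iff \<alpha>_simps(2))
qed (simp_all add: Gam_mul Gam_invol nrm_Gam)

lemma Gam_image_carrier:
  "Gam \<alpha> ` carrier (twisted_conv_algebra \<alpha> \<omega> \<L> N) = covariant_kernels \<alpha> \<omega> \<L> N"
proof (intro equalityI subsetI)
  fix K assume "K \<in> Gam \<alpha> ` carrier (twisted_conv_algebra \<alpha> \<omega> \<L> N)"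
  then show "K \<in> covariant_kernels \<alpha> \<omega> \<L> N"
    using Gam_isometric_star_morphism
    by (auto simp: covariant_kernels_def Gam_covariant isometric_star_morphism_def)
next
  fix K assume "K \<in> covariant_kernels \<alpha> \<omega> \<L> N"
  then have "K \<in> carrier (kernel_algebra \<alpha> \<omega> \<L> N)" "Gam \<alpha> (\<lambda>x. \<alpha> x (K x 0)) = K"
    by (auto simp: covariant_kernels_def intro: Gam_right_inverse)
  then show "K \<in> Gam \<alpha> ` carrier (twisted_conv_algebra \<alpha> \<omega> \<L> N)"
    using kernel_column_in_carrier by (metis imageI)
qed

end

lemma inj_Gam: "inj (Gam \<alpha>)"
  by (rule inj_on_inverseI[where g = "\<lambda>K x. \<alpha> x (K x 0)"]) (simp add: Gam_left_inverse)

end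

theorem proposition3p4:
  fixes \<alpha> :: "'g::group_add \<Rightarrow> 'a::cstar_algebra \<Rightarrow> 'a"
    and \<omega> :: "'g \<Rightarrow> 'g \<Rightarrow> 'a double_map"
    and \<L> :: "('g \<Rightarrow> complex) set"
    and N :: "('g \<Rightarrow> complex) \<Rightarrow> real"
  assumes "twisted_cstar_system \<alpha> \<omega>"
    and "admissible_algebra \<L> N"
  shows "isometric_star_morphism
           (twisted_conv_algebra \<alpha> \<omega> \<L> N) (kernel_algebra \<alpha> \<omega> \<L> N) (Gam \<alpha>) \<and>
         Gam \<alpha> ` carrier (twisted_conv_algebra \<alpha> \<omega> \<L> N) = covariant_kernels \<alpha> \<omega> \<L> N \<and>
         inj_on (Gam \<alpha>) (carrier (twisted_conv_algebra \<alpha> \<omega> \<L> N)) \<and>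
         (\<forall>K\<in>covariant_kernels \<alpha> \<omega> \<L> N.
            the_inv_into (carrier (twisted_conv_algebra \<alpha> \<omega> \<L> N)) (Gam \<alpha>) K = (\<lambda>x. \<alpha> x (K x 0)))"
proof -
  interpret twisted_cstar_system \<alpha> \<omega> by fact
  have inj: "inj_on (Gam \<alpha>) (carrier (twisted_conv_algebra \<alpha> \<omega> \<L> N))"
    using inj_Gam by (rule inj_on_subset) simp
  have "the_inv_into (carrier (twisted_conv_algebra \<alpha> \<omega> \<L> N)) (Gam \<alpha>) K = (\<lambda>x. \<alpha> x (K x 0))"
    if "K \<in> covariant_kernels \<alpha> \<omega> \<L> N" for K
    using that kernel_column_in_carrier[OF assms(2)]
    by (intro the_inv_into_f_eq[OF inj] Gam_right_inverse) (auto simp: covariant_kernels_def)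
  then show ?thesis
    using inj Gam_isometric_star_morphism[OF assms(2)] Gam_image_carrier[OF assms(2)] by blast
qed

end
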